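(* For any Dyck path $d$ of semilength $n$, we have $m_d = 2n - 1 - \mathrm{bpk}(d)$, where $m_d=\deg C_d(t)$ and $\mathrm{bpk}(d)$ is the number of peaks of the bounce path of $d$.
   Context: A Dyck path of semilength $n$ is a lattice path from $(0,0)$ to $(2n,0)$ with steps $U=(1,1)$ and $D=(1,-1)$ never going below the $x$-axis. A peak is an occurrence of $UD$. The bounce path of $d$ is constructed as follows: start at $(0,0)$ and take up-steps until reaching a point of $d$ at which $d$'s next step is a down-step; then take down-steps until reaching the $x$-axis; then again take up-steps until encountering a down-step of $d$, and repeat until $(2n,0)$ is reached. $\mathrm{bpk}(d)$ is the number of peaks of the bounce path. For $\sigma=\sigma_1\cdots\sigma_n\in\mathfrak{S}_n$, $\mathrm{can}(d,\sigma)$ is the word of length $2n$ obtained by labeling the $i$-th up-step and the $i$-th down-step of $d$ with $\sigma_i$ and reading labels left to right. $\mathrm{des}(d,\sigma)$ is the number of indices $j\in[2n-1]$ with $\mathrm{can}(d,\sigma)_j>\mathrm{can}(d,\sigma)_{j+1}$. $C_d(t)=\sum_{\sigma\in\mathfrak{S}_n} t^{\mathrm{des}(d,\sigma)}$ and $m_d=\deg C_d(t)$. *)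

theory Defs
  imports "HOL-Combinatorics.Permutations" "HOL-Computational_Algebra.Polynomial"
begin

datatype step = U | D

type_synonym path = "step list"

fun rise :: "step \<Rightarrow> int" where
  "rise U = 1"
| "rise D = -1"

text \<open>The point of a path at abscissa \<open>x\<close> is \<open>(x, height p x)\<close>.\<close>

definition height :: "path \<Rightarrow> nat \<Rightarrow> int" where
  "height p x = (\<Sum>s\<leftarrow>take x p. rise s)"

definition dyck_path :: "nat \<Rightarrow> path \<Rightarrow> bool" where
  "dyck_path n d \<longleftrightarrow>
     length d = 2 * n \<and> height d (2 * n) = 0 \<and> (\<forall>x \<le> 2 * n. height d x \<ge> 0)"

definition semilength :: "path \<Rightarrow> nat" where
  "semilength d = length d div 2"

definition peaks :: "path \<Rightarrow> nat" where
  "peaks p = card {i. Suc i < length p \<and> p ! i = U \<and> p ! Suc i = D}"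

text \<open>
  \<open>bounce_from d s x y\<close> is the part of the bounce path of \<open>d\<close> from the point \<open>(x, y)\<close> onwards,
  where \<open>s\<close> is the direction currently followed.  For a Dyck path \<open>d\<close> an ascent starting on the
  axis always consists of at least one up-step, so after a descent the up-step can be taken at once.
\<close>

function bounce_from :: "path \<Rightarrow> step \<Rightarrow> nat \<Rightarrow> int \<Rightarrow> path" where
  "bounce_from d U x y =
     (if x \<ge> length d then []
      else if height d x = y \<and> d ! x = D then D # bounce_from d D (x + 1) (y - 1)
      else U # bounce_from d U (x + 1) (y + 1))"
| "bounce_from d D x y =
     (if x \<ge> length d then []
      else if y = 0 then U # bounce_from d U (x + 1) (y + 1)
      else D # bounce_from d D (x + 1) (y - 1))"
  by pat_completeness auto
termination
  by (relation "measure (\<lambda>(d, s, x, y). length d - x)") auto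

declare bounce_from.simps [simp del]

definition bounce_path :: "path \<Rightarrow> path" where
  "bounce_path d = bounce_from d U 0 0"

definition bpk :: "path \<Rightarrow> nat" where
  "bpk d = peaks (bounce_path d)"

text \<open>
  If the step at position \<open>j\<close> (counted from 0) is the \<open>i\<close>-th step of its kind, then
  \<open>i = count_list (take (Suc j) d) (d ! j)\<close>.
\<close>

definition can :: "path \<Rightarrow> (nat \<Rightarrow> nat) \<Rightarrow> nat list" where
  "can d \<sigma> = map (\<lambda>j. \<sigma> (count_list (take (Suc j) d) (d ! j))) [0..<length d]"

definition des :: "path \<Rightarrow> (nat \<Rightarrow> nat) \<Rightarrow> nat" where
  "des d \<sigma> = card {j. Suc j < length (can d \<sigma>) \<and> can d \<sigma> ! j > can d \<sigma> ! Suc j}"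

definition C_poly :: "path \<Rightarrow> int poly" where
  "C_poly d = (\<Sum>\<sigma> | \<sigma> permutes {1..semilength d}. monom 1 (des d \<sigma>))"

definition m_deg :: "path \<Rightarrow> nat" where
  "m_deg d = degree (C_poly d)"

end

theory Submission
  imports Defs "HOL-Library.Sublist"
begin

text \<open>
  Let \<open>w\<close> be the word of indices read along \<open>d\<close>, so that \<open>can d \<sigma> = map \<sigma> w\<close>, and cut \<open>w\<close> greedily
  into maximal factors without a repeated letter.  A cut happens exactly where the bounce path turns
  from an ascent to a descent, so there are \<open>bpk d\<close> cuts.  Between two consecutive cuts
  the word runs through a cycle (it leaves an index and comes back to it), and \<open>\<sigma>\<close> cannot
  decrease strictly along a cycle, so every \<open>\<sigma>\<close> has at least \<open>bpk d\<close> non-descents.  Conversely, read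
  \<open>w\<close> from left to right and build a linear order by inserting each new index directly after the
  index read last; numbering this order decreasingly gives a \<open>\<sigma>\<close> whose non-descents all
  occur at cuts.
\<close>

section \<open>Counting adjacent pairs\<close>

definition adj :: "('a \<Rightarrow> 'a \<Rightarrow> bool) \<Rightarrow> 'a list \<Rightarrow> nat" where
  "adj P xs = card {i. Suc i < length xs \<and> P (xs ! i) (xs ! Suc i)}"

lemma finite_adj: "finite {i. Suc i < length xs \<and> Q i}"
  by (rule finite_subset [of _ "{..<length xs}"]) auto

lemma adj_Nil [simp]: "adj P [] = 0"
  and adj_single [simp]: "adj P [x] = 0"
  by (simp_all add: adj_def)

lemma adj_Cons_Cons [simp]:
  "adj P (x # y # zs) = (if P x y then 1 else 0) + adj P (y # zs)"
proof -
  let ?A = "{i. Suc i < length (y # zs) \<and> P ((y # zs) ! i) ((y # zs) ! Suc i)}"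
  let ?B = "{i. Suc i < length (x # y # zs) \<and> P ((x # y # zs) ! i) ((x # y # zs) ! Suc i)}"
  have "i \<in> ?B \<longleftrightarrow> i \<in> (if P x y then {0} else {}) \<union> Suc ` ?A" for i
    by (cases i) (auto simp: image_iff)
  then have "?B = (if P x y then {0} else {}) \<union> Suc ` ?A"
    by blast
  moreover have "finite ?A"
    by (rule finite_adj)
  moreover have "card (Suc ` ?A) = card ?A"
    by (simp add: card_image)
  ultimately show ?thesis
    unfolding adj_def by (subst \<open>?B = _\<close>, subst card_Un_disjoint) auto
qed

lemma adj_compl: "adj P xs + adj (\<lambda>x y. \<not> P x y) xs = length xs - 1"
  by (induction xs rule: induct_list012) auto

lemma peaks_eq_adj: "peaks p = adj (\<lambda>x y. x = U \<and> y = D) p"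
  by (simp add: peaks_def adj_def)

section \<open>The word of indices and its greedy cuts\<close>

text \<open>\<open>i\<close> and \<open>j\<close> are the indices of the next up-step and the next down-step.\<close>

fun index_word :: "path \<Rightarrow> nat \<Rightarrow> nat \<Rightarrow> nat list" where
  "index_word [] i j = []"
| "index_word (U # s) i j = i # index_word s (Suc i) j"
| "index_word (D # s) i j = j # index_word s i (Suc j)"

lemma index_word_eq_map:
  "index_word s (Suc (count_list p U)) (Suc (count_list p D)) =
     map (\<lambda>k. count_list (take (Suc k) (p @ s)) ((p @ s) ! k)) [length p..<length (p @ s)]"
proof (induction s arbitrary: p)
  case Nil
  then show ?case by simp
next
  case (Cons x s)
  show ?case
    using Cons.IH [of "p @ [x]"] by (cases x) (simp_all add: upt_conv_Cons nth_append del: upt_Suc)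
qed

lemma can_eq_index_word: "can d \<sigma> = map \<sigma> (index_word d 1 1)"
  using index_word_eq_map [of d "[]"] by (simp add: can_def)

lemma length_index_word [simp]: "length (index_word s i j) = length s"
  by (induction s i j rule: index_word.induct) auto

text \<open>
  Reading \<open>s\<close>, the up-steps that still wait for their down-step form a queue: first \<open>a\<close>
  indices from before the last cut, then \<open>b\<close> indices read since the last cut.  A down-step repeats a
  letter of the current factor exactly when \<open>a = 0\<close>.  The value for a down-step at \<open>a = b = 0\<close> is
  irrelevant.
\<close>

fun cuts :: "path \<Rightarrow> nat \<Rightarrow> nat \<Rightarrow> nat" where
  "cuts [] a b = 0"
| "cuts (U # s) a b = cuts s a (Suc b)"
| "cuts (D # s) (Suc a) b = cuts s a b"
| "cuts (D # s) 0 (Suc b) = Suc (cuts s b 0)"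
| "cuts (D # s) 0 0 = 0"

section \<open>Cuts are the peaks of the bounce path\<close>

definition stays_nonneg :: "nat \<Rightarrow> path \<Rightarrow> bool" where
  "stays_nonneg h s \<longleftrightarrow> (\<forall>x \<le> length s. int h + height s x \<ge> 0)"

lemma height_0 [simp]: "height s 0 = 0"
  by (simp add: height_def)

lemma height_Cons_Suc [simp]: "height (x # s) (Suc k) = rise x + height s k"
  by (simp add: height_def)

lemma height_append_Cons:
  "height ((p @ [x]) @ s) (length (p @ [x])) = height (p @ x # s) (length p) + rise x"
  by (simp add: height_def)

lemma stays_nonneg_U: "stays_nonneg h (U # s) \<Longrightarrow> stays_nonneg (Suc h) s"
  unfolding stays_nonneg_def
proof (intro allI impI)
  fix x
  assume "\<forall>x\<le>length (U # s). 0 \<le> int h + height (U # s) x" "x \<le> length s"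
  then show "0 \<le> int (Suc h) + height s x"
    by (auto dest!: spec [of _ "Suc x"])
qed

lemma stays_nonneg_D:
  assumes "stays_nonneg h (D # s)"
  obtains h' where "h = Suc h'" "stays_nonneg h' s"
proof -
  have *: "0 \<le> int h - 1 + height s x" if "x \<le> length s" for x
    using assms that unfolding stays_nonneg_def by (auto dest!: spec [of _ "Suc x"])
  from * [of 0] obtain h' where h': "h = Suc h'"
    by (cases h) auto
  with * that show thesis
    by (auto simp: stays_nonneg_def)
qed

text \<open>
  Since the last cut, the bounce path has made as many steps as \<open>d\<close>; hence its height is
  \<open>a - b\<close> while it descends and \<open>b - a\<close> while it ascends.
\<close>

lemma peaks_bounce_from:
  assumes "stays_nonneg (a + b) s" and "height (p @ s) (length p) = int (a + b)"
  shows "adj (\<lambda>x y. x = U \<and> y = D) (U # bounce_from (p @ s) U (length p) (int b - int a)) = cuts s a b"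
    and "b \<le> a \<Longrightarrow>
      adj (\<lambda>x y. x = U \<and> y = D) (D # bounce_from (p @ s) D (length p) (int a - int b)) = cuts s a b"
  using assms
proof (induction s arbitrary: p a b)
  case Nil
  {
    case 1 then show ?case by (simp add: bounce_from.simps)
  next
    case 2 then show ?case by (simp add: bounce_from.simps)
  }
next
  case (Cons x s)
  {
    case 1
    show ?case
    proof (cases x)
      case U
      have "stays_nonneg (a + Suc b) s"
        using 1 U stays_nonneg_U by simp
      moreover have "height ((p @ [x]) @ s) (length (p @ [x])) = int (a + Suc b)"
        unfolding height_append_Cons using 1 U by simp
      ultimately show ?thesis
        using Cons.IH(1) [of a "Suc b" "p @ [x]"] U
        by (simp add: bounce_from.simps(1) [of _ "length p"] algebra_simps)
    next
      case D
      obtain h where h: "a + b = Suc h" "stays_nonneg h s"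
        using 1 D stays_nonneg_D by metis
      have height': "height ((p @ [x]) @ s) (length (p @ [x])) = int h"
        unfolding height_append_Cons using 1 D h(1) by simp
      show ?thesis
      proof (cases a)
        \<comment> \<open>For \<open>a = 0\<close> the ascent meets \<open>d\<close> just before a
          down-step, so the bounce path turns: one peak, one cut.\<close>
        case 0
        then show ?thesis
          using Cons.IH(2) [of 0 h "p @ [x]"] 1 D height' h
          by (simp add: bounce_from.simps(1) [of _ "length p"])
      next
        case (Suc a')
        then show ?thesis
          using Cons.IH(1) [of a' b "p @ [x]"] 1 D height' h
          by (simp add: bounce_from.simps(1) [of _ "length p"] algebra_simps)
      qed
    qed
  next
    case 2
    show ?case
    proof (cases x)
      case U
      have "stays_nonneg (a + Suc b) s"
        using 2 U stays_nonneg_U by simp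
      moreover have "height ((p @ [x]) @ s) (length (p @ [x])) = int (a + Suc b)"
        unfolding height_append_Cons using 2 U by simp
      ultimately show ?thesis
        \<comment> \<open>\<open>a = b\<close> means that the descent has reached the axis, so the
          bounce path ascends from here.\<close>
        using Cons.IH(1) [of a "Suc b" "p @ [x]"] Cons.IH(2) [of "Suc b" a "p @ [x]"] U \<open>b \<le> a\<close>
        by (cases "a = b") (simp_all add: bounce_from.simps(2) [of _ "length p"] algebra_simps)
    next
      case D
      obtain h where h: "a + b = Suc h" "stays_nonneg h s"
        using 2 D stays_nonneg_D by metis
      have height': "height ((p @ [x]) @ s) (length (p @ [x])) = int h"
        unfolding height_append_Cons using 2 D h(1) by simp
      obtain a' where "a = Suc a'"
        using h 2 by (cases a) auto
      then show ?thesis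
        using Cons.IH(1) [of a' b "p @ [x]"] Cons.IH(2) [of b a' "p @ [x]"] 2 D height' h
        by (cases "a = b") (simp_all add: bounce_from.simps(2) [of _ "length p"] algebra_simps)
    qed
  }
qed

section \<open>Every labelling has a non-descent for each cut\<close>

text \<open>
  \<open>c\<close> is the index read last and \<open>j + a\<close> is the first index read since the last cut.  If
  \<open>\<sigma> c > \<sigma> (j + a)\<close>, a non-descent has already occurred in the current factor.
\<close>

lemma cuts_le_nondescents:
  assumes "i = j + a + b"
  shows "cuts s a b \<le> adj (\<lambda>x y. \<not> x > y) (map \<sigma> (c # index_word s i j)) +
           (if b > 0 \<and> \<sigma> c > (\<sigma> (j + a) :: nat) then 1 else 0)"
  using assms
proof (induction s a b arbitrary: i j c rule: cuts.induct)
  case (2 s a b)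
  show ?case
    using "2.IH" [of "Suc i" j i] "2.prems" by (auto split: if_splits)
next
  case (3 s a b)
  show ?case
    using "3.IH" [of i "Suc j" j] "3.prems" by (auto split: if_splits)
next
  \<comment> \<open>The return to \<open>j\<close> is a non-descent unless
    \<open>\<sigma> c > \<sigma> j\<close>, in which case the extra summand pays for the
    cut.\<close>
  case (4 s b)
  show ?case
    using "4.IH" [of i "Suc j" j] "4.prems" by (auto split: if_splits)
qed auto

section \<open>A labelling whose non-descents occur only at cuts\<close>

lemma sorted_wrt_subseq: "subseq xs ys \<Longrightarrow> sorted_wrt P ys \<Longrightarrow> sorted_wrt P xs"
  by (induction rule: list_emb.induct) (auto dest: list_emb_set)

text \<open>
  \<open>L @ R\<close> is the linear order built so far, and the index read last is the last entry of \<open>L\<close>.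
\<close>

lemma ex_order_nondescents_le_cuts:
  assumes "i = j + a + b" "stays_nonneg (a + b) s" "1 \<le> i"
    and "L \<noteq> []" "distinct (L @ R)" "set (L @ R) = {1..<i}"
    and "subseq [j..<j + a] R" "subseq [j + a..<i] L"
  shows "\<exists>M. distinct M \<and> set M = {1..<i + count_list s U} \<and> subseq (L @ R) M \<and>
           (\<forall>\<sigma> :: nat \<Rightarrow> nat. sorted_wrt (\<lambda>x y. \<sigma> x > \<sigma> y) M \<longrightarrow>
              adj (\<lambda>x y. \<not> x > y) (map \<sigma> (last L # index_word s i j)) \<le> cuts s a b)"
  using assms
proof (induction s a b arbitrary: i j L R rule: cuts.induct)
  case (1 a b)
  then show ?case
    by (intro exI [of _ "L @ R"]) auto
next
  case (2 s a b)
  have "subseq [j + a..<Suc i] (L @ [i])"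
    using "2.prems" by (simp add: list_emb_append_mono)
  moreover have "distinct ((L @ [i]) @ R)" "set ((L @ [i]) @ R) = {1..<Suc i}"
    using "2.prems" by auto
  moreover have "stays_nonneg (a + Suc b) s"
    using "2.prems" stays_nonneg_U by simp
  ultimately obtain M where M: "distinct M" "set M = {1..<Suc i + count_list s U}"
      "subseq ((L @ [i]) @ R) M"
      "\<And>\<sigma> :: nat \<Rightarrow> nat. sorted_wrt (\<lambda>x y. \<sigma> x > \<sigma> y) M \<Longrightarrow>
         adj (\<lambda>x y. \<not> x > y) (map \<sigma> (i # index_word s (Suc i) j)) \<le> cuts s a (Suc b)"
    using "2.IH" [of "Suc i" j "L @ [i]" R] "2.prems" by auto
  have "subseq (L @ R) ((L @ [i]) @ R)"
    by (intro list_emb_append_mono) auto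
  then have "subseq (L @ R) M"
    using M(3) subseq_order.order_trans by blast
  moreover have "adj (\<lambda>x y. \<not> x > y) (map \<sigma> (last L # index_word (U # s) i j)) \<le> cuts (U # s) a b"
    if "sorted_wrt (\<lambda>x y. \<sigma> x > \<sigma> y) M" for \<sigma> :: "nat \<Rightarrow> nat"
  proof -
    have "\<sigma> (last L) > \<sigma> i"
      using sorted_wrt_subseq [OF M(3) that] \<open>L \<noteq> []\<close> by (auto simp: sorted_wrt_append)
    then show ?thesis
      using M(4) [OF that] by simp
  qed
  ultimately show ?case
    using M(1,2) by (intro exI [of _ M]) auto
next
  case (3 s a b)
  \<comment> \<open>Indices waiting since before the last cut lie in \<open>R\<close>, so reading
    \<open>j\<close> moves right in the order: a descent.\<close>
  obtain R1 R2 where R: "R = R1 @ j # R2" "subseq [Suc j..<Suc j + a] R2"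
    using \<open>subseq [j..<j + Suc a] R\<close>
    by (auto simp: upt_conv_Cons simp del: upt_Suc dest!: list_emb_ConsD)
  have "subseq [Suc j + a..<i] (L @ R1 @ [j])"
    using "3.prems" by (auto intro: subseq_rev_drop_many)
  moreover have "stays_nonneg (a + b) s"
    using "3.prems" stays_nonneg_D by fastforce
  moreover have "distinct ((L @ R1 @ [j]) @ R2)" "set ((L @ R1 @ [j]) @ R2) = {1..<i}"
    using "3.prems" R by auto
  ultimately obtain M where M: "distinct M" "set M = {1..<i + count_list s U}"
      "subseq ((L @ R1 @ [j]) @ R2) M"
      "\<And>\<sigma> :: nat \<Rightarrow> nat. sorted_wrt (\<lambda>x y. \<sigma> x > \<sigma> y) M \<Longrightarrow>
         adj (\<lambda>x y. \<not> x > y) (map \<sigma> (j # index_word s i (Suc j))) \<le> cuts s a b"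
    using "3.IH" [of i "Suc j" "L @ R1 @ [j]" R2] "3.prems" R(2) by auto
  have "adj (\<lambda>x y. \<not> x > y) (map \<sigma> (last L # index_word (D # s) i j)) \<le> cuts (D # s) (Suc a) b"
    if "sorted_wrt (\<lambda>x y. \<sigma> x > \<sigma> y) M" for \<sigma> :: "nat \<Rightarrow> nat"
  proof -
    have "\<sigma> (last L) > \<sigma> j"
      using sorted_wrt_subseq [OF M(3) that] \<open>L \<noteq> []\<close> by (auto simp: sorted_wrt_append)
    then show ?thesis
      using M(4) [OF that] by simp
  qed
  then show ?case
    using M R(1) by (intro exI [of _ M]) auto
next
  case (4 s b)
  have i: "i = j + Suc b"
    using "4.prems" by simp
  \<comment> \<open>Here \<open>j\<close> lies in \<open>L\<close>, so this step is no descent;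
    moving \<open>L2\<close> to the right part puts the indices still waiting after
    \<open>j\<close>.\<close>
  obtain L1 L2 where L: "L = L1 @ j # L2" "subseq [Suc j..<i] L2"
    using \<open>subseq [j + 0..<i] L\<close> i
    by (auto simp: upt_conv_Cons simp del: upt_Suc dest!: list_emb_ConsD)
  have "subseq [Suc j..<Suc j + b] (L2 @ R)"
    using L i by (auto intro: subseq_rev_drop_many)
  moreover have "stays_nonneg (b + 0) s"
    using "4.prems" stays_nonneg_D by fastforce
  moreover have "distinct ((L1 @ [j]) @ L2 @ R)" "set ((L1 @ [j]) @ L2 @ R) = {1..<i}"
    using "4.prems" L by auto
  ultimately obtain M where M: "distinct M" "set M = {1..<i + count_list s U}"
      "subseq ((L1 @ [j]) @ L2 @ R) M"
      "\<And>\<sigma> :: nat \<Rightarrow> nat. sorted_wrt (\<lambda>x y. \<sigma> x > \<sigma> y) M \<Longrightarrow>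
         adj (\<lambda>x y. \<not> x > y) (map \<sigma> (j # index_word s i (Suc j))) \<le> cuts s b 0"
    using "4.IH" [of i "Suc j" "L1 @ [j]" "L2 @ R"] "4.prems" i by auto
  then show ?case
    using L(1) by (intro exI [of _ M]) (auto intro: le_SucI)
next
  case (5 s)
  show ?case
    using "5.prems" stays_nonneg_D by fastforce
qed

lemma ex_permutes_sorted_wrt:
  assumes "distinct M" "set M = {1..n}"
  obtains \<sigma> where "\<sigma> permutes {1..n}" "sorted_wrt (\<lambda>x y. \<sigma> x > (\<sigma> y :: nat)) M"
proof -
  have len: "length M = n"
    using distinct_card [OF assms(1)] assms(2) by simp
  have "bij_betw (\<lambda>k. M ! k) {..<n} {1..n}"
    using bij_betw_nth [OF assms(1)] assms(2) len by blast
  then have pos: "bij_betw (the_inv_into {..<n} (\<lambda>k. M ! k)) {1..n} {..<n}"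
    by (rule bij_betw_the_inv_into)
  have rev: "bij_betw (\<lambda>k. n - k) {..<n} {1..n}"
    by (rule bij_betw_byWitness [where f' = "\<lambda>k. n - k"]) auto
  \<comment> \<open>The inverse gives the position in \<open>M\<close>; entry \<open>k\<close>,
    counted from 0, receives the label \<open>n - k\<close>.\<close>
  define \<tau> where "\<tau> = (\<lambda>k. n - k) \<circ> the_inv_into {..<n} (\<lambda>k. M ! k)"
  define \<sigma> where "\<sigma> x = (if x \<in> {1..n} then \<tau> x else x)" for x
  have "bij_betw \<tau> {1..n} {1..n}"
    unfolding \<tau>_def using pos rev by (rule bij_betw_trans)
  then have "bij_betw \<sigma> {1..n} {1..n}"
    by (subst bij_betw_cong [of _ _ \<tau>]) (auto simp: \<sigma>_def)
  then have "\<sigma> permutes {1..n}"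
    by (rule bij_imp_permutes) (auto simp: \<sigma>_def)
  moreover have "\<sigma> (M ! k) = n - k" if "k < n" for k
  proof -
    have "M ! k \<in> {1..n}"
      using that len assms(2) nth_mem by metis
    moreover have "the_inv_into {..<n} (\<lambda>k. M ! k) (M ! k) = k"
      using that len assms(1) by (intro the_inv_into_f_f) (auto simp: inj_on_def nth_eq_iff_index_eq)
    ultimately show ?thesis
      by (simp add: \<sigma>_def \<tau>_def)
  qed
  then have "sorted_wrt (\<lambda>x y. \<sigma> x > \<sigma> y) M"
    by (auto simp: sorted_wrt_iff_nth_less len)
  ultimately show thesis
    by (rule that)
qed

section \<open>The degree\<close>

text \<open>All coefficients are positive, so equal monomials cannot cancel.\<close>

lemma degree_sum_monom:
  fixes f :: "'b \<Rightarrow> nat"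
  assumes "finite S" "s \<in> S" "\<And>x. x \<in> S \<Longrightarrow> f x \<le> f s"
  shows "degree (\<Sum>x\<in>S. monom (1 :: 'a :: linordered_idom) (f x)) = f s"
proof (rule antisym)
  show "degree (\<Sum>x\<in>S. monom (1 :: 'a) (f x)) \<le> f s"
    using assms by (intro degree_sum_le) (auto simp: degree_monom_eq)
  have "coeff (\<Sum>x\<in>S. monom (1 :: 'a) (f x)) (f s) = (\<Sum>x\<in>S. if f x = f s then 1 else 0)"
    by (simp add: coeff_sum)
  also have "\<dots> > 0"
    by (rule sum_pos2 [OF assms(1,2)]) auto
  finally show "f s \<le> degree (\<Sum>x\<in>S. monom (1 :: 'a) (f x))"
    by (intro le_degree) simp
qed

lemma height_eq_count: "height p (length p) = int (count_list p U) - int (count_list p D)"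
proof (induction p)
  case (Cons x p)
  then show ?case by (cases x) simp_all
qed simp

lemma length_eq_count: "length (p :: path) = count_list p U + count_list p D"
proof (induction p)
  case (Cons x p)
  then show ?case by (cases x) simp_all
qed simp

theorem theorem3p9:
  fixes n :: nat and d :: path
  assumes "n \<ge> 1" and "dyck_path n d"
  shows "int (m_deg d) = 2 * int n - 1 - int (bpk d)"
proof -
  have len: "length d = 2 * n" and end0: "height d (2 * n) = 0" and nonneg: "stays_nonneg 0 d"
    using assms(2) by (auto simp: dyck_path_def stays_nonneg_def)
  have countU: "count_list d U = n"
    using height_eq_count [of d] length_eq_count [of d] len end0 by simp
  \<comment> \<open>The lemmas on \<open>cuts\<close> presuppose a step already read, so the first
    up-step is split off, leaving \<open>a = 0\<close> and \<open>b = 1\<close>.\<close>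
  obtain x s where "d = x # s"
    using assms(1) len by (cases d) auto
  moreover have "x \<noteq> D"
    using nonneg \<open>d = x # s\<close> stays_nonneg_D by blast
  ultimately have d: "d = U # s"
    by (cases x) auto
  have s: "stays_nonneg (0 + 1) s"
    using nonneg d stays_nonneg_U by simp
  have bpk: "bpk d = cuts s 0 1"
    using peaks_bounce_from(1) [OF s, of "[U]"] d
    by (simp add: bpk_def bounce_path_def peaks_eq_adj bounce_from.simps(1) [of _ 0])
  have word: "can d \<sigma> = map \<sigma> (1 # index_word s 2 1)" for \<sigma>
    by (simp add: can_eq_index_word d numeral_2_eq_2)
  have des: "des d \<sigma> + adj (\<lambda>x y. \<not> x > y) (can d \<sigma>) = 2 * n - 1" for \<sigma>
    using adj_compl [of "\<lambda>x y. x > y" "can d \<sigma>"] len by (simp add: des_def adj_def can_def)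
  have le: "cuts s 0 1 \<le> adj (\<lambda>x y. \<not> x > y) (can d \<sigma>)" for \<sigma>
    using cuts_le_nondescents [of 2 1 0 1 s \<sigma> 1] by (simp add: word)
  obtain M where M: "distinct M" "set M = {1..<2 + count_list s U}"
      "\<And>\<sigma> :: nat \<Rightarrow> nat. sorted_wrt (\<lambda>x y. \<sigma> x > \<sigma> y) M \<Longrightarrow>
         adj (\<lambda>x y. \<not> x > y) (map \<sigma> (1 # index_word s 2 1)) \<le> cuts s 0 1"
    using ex_order_nondescents_le_cuts [of 2 1 0 1 s "[1]" "[]"] s
    by (auto simp: numeral_2_eq_2)
  have "set M = {1..n}"
    using M(2) countU d by auto
  then obtain \<sigma> where \<sigma>: "\<sigma> permutes {1..n}" "sorted_wrt (\<lambda>x y. \<sigma> x > \<sigma> y) M"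
    using ex_permutes_sorted_wrt M(1) by blast
  then have eq: "adj (\<lambda>x y. \<not> x > y) (can d \<sigma>) = cuts s 0 1"
    using M(3) [OF \<sigma>(2)] le [of \<sigma>] by (simp add: word)
  have "des d \<tau> \<le> des d \<sigma>" for \<tau>
    using des [of \<tau>] des [of \<sigma>] le [of \<tau>] eq by linarith
  then have "m_deg d = des d \<sigma>"
    unfolding m_deg_def C_poly_def using \<sigma>(1) len
    by (intro degree_sum_monom) (auto simp: semilength_def finite_permutations)
  then show ?thesis
    using des [of \<sigma>] eq bpk assms(1) by linarith
qed

end
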